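(* Let $(\mathfrak{X},d)$ be a compact metric space (nonempty) and let $\delta,\sigma,\iota,\alpha:\ell^\infty(\mathfrak{X})\to\mathbb{R}$ be $\delta(f)=\|f\|_\infty$, $\sigma(f)=\sup_{\mathfrak{X}}f$, $\iota(f)=\inf_{\mathfrak{X}}f$, $\alpha(f)=\sup_{\mathfrak{X}}f-\inf_{\mathfrak{X}}f$. The maps $\sigma$, $\iota$ and $\alpha$ are Hadamard directionally differentiable at any $f\in\ell^\infty(\mathfrak{X})$ tangentially to the set $\mathcal{C}(\mathfrak{X},d)$ with derivatives, for $g\in\mathcal{C}(\mathfrak{X},d)$, $$\sigma'_f(g)=\sup_{A_0(f)}g,\qquad \iota'_f(g)=\inf_{B_0(f)}g,\qquad \alpha'_f(g)=\sup_{A_0(f)}g-\inf_{B_0(f)}g.$$ If additionally $f\in\mathcal{C}(\mathfrak{X},d)\setminus\{0\}$, then $\delta,\sigma,\iota,\alpha$ are Hadamard directionally differentiable at $f$ tangentially to $\mathcal{C}(\mathfrak{X},d)$ with derivatives, for $g\in\mathcal{C}(\mathfrak{X},d)$, $$\delta'_f(g)=\sup_{M^+(|f|)}\big(g\cdot\operatorname{sgn}(f)\big),\quad \sigma'_f(g)=\sup_{M^+(f)}g,\quad \iota'_f(g)=\inf_{M^-(f)}g,\quad \alpha'_f(g)=\sup_{M^+(f)}g-\inf_{M^-(f)}g.$$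
   Context: $\ell^\infty(\mathfrak{X})$ is the real Banach space of bounded functions $f:\mathfrak{X}\to\mathbb{R}$ with norm $\|f\|_\infty=\sup_{x\in\mathfrak{X}}|f(x)|$; $\mathcal{C}(\mathfrak{X},d)$ is the subset of continuous functions in $\ell^\infty(\mathfrak{X})$; $\operatorname{sgn}$ is the sign function. For $h\in\ell^\infty(\mathfrak{X})$: $A_0(h)=\{x\in\mathfrak{X}:\exists\{x_n\}\subset\mathfrak{X},\ x_n\to x,\ h(x_n)\to\sup_{\mathfrak{X}}h\}$, $B_0(h)=\{x\in\mathfrak{X}:\exists\{x_n\}\subset\mathfrak{X},\ x_n\to x,\ h(x_n)\to\inf_{\mathfrak{X}}h\}$, $M^+(h)=\{x\in\mathfrak{X}:h(x)=\sup_{\mathfrak{X}}h\}$, $M^-(h)=\{x\in\mathfrak{X}:h(x)=\inf_{\mathfrak{X}}h\}$. Hadamard directional differentiability: let $\mathcal{D},\mathcal{E}$ be real Banach spaces. A map $\phi:\mathcal{D}\to\mathcal{E}$ is Hadamard directionally differentiable at $\theta\in\mathcal{D}$ tangentially to a set $\mathcal{D}_0\subset\mathcal{D}$ if there is a map $\phi'_\theta:\mathcal{D}_0\to\mathcal{E}$ (the derivative, not required to be linear) such that $\big\|\frac{\phi(\theta+t_nh_n)-\phi(\theta)}{t_n}-\phi'_\theta(h)\big\|_{\mathcal{E}}\to0$ for all $h\in\mathcal{D}_0$ and all sequences $\{t_n\}\subset\mathbb{R}$, $\{h_n\}\subset\mathcal{D}$ with $t_n\downarrow0$ and $\|h_n-h\|_{\mathcal{D}}\to0$.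 *)

theory Defs
  imports "HOL-Analysis.Analysis"
begin

section \<open>The Banach space of bounded real functions\<close>

typedef 'a linfty = "{f :: 'a \<Rightarrow> real. bounded (range f)}"
  morphisms apply_linfty Linfty
  by (rule exI[of _ "\<lambda>_. 0"]) simp

setup_lifting type_definition_linfty

lemma bounded_apply_linfty: "bounded (range (apply_linfty f))"
  using apply_linfty[of f] by simp

lemma linfty_eqI: "(\<And>x. apply_linfty f x = apply_linfty g x) \<Longrightarrow> f = g"
  by (simp add: apply_linfty_inject[symmetric] fun_eq_iff)

instantiation linfty :: (type) real_vector
begin

lift_definition zero_linfty :: "'a linfty" is "\<lambda>_. 0"
  by simp

lift_definition plus_linfty :: "'a linfty \<Rightarrow> 'a linfty \<Rightarrow> 'a linfty" is "\<lambda>f g x. f x + g x"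
  by (rule bounded_plus_comp)

lift_definition uminus_linfty :: "'a linfty \<Rightarrow> 'a linfty" is "\<lambda>f x. - f x"
  by (simp add: bounded_iff)

lift_definition minus_linfty :: "'a linfty \<Rightarrow> 'a linfty \<Rightarrow> 'a linfty" is "\<lambda>f g x. f x - g x"
  by (rule bounded_minus_comp)

lift_definition scaleR_linfty :: "real \<Rightarrow> 'a linfty \<Rightarrow> 'a linfty" is "\<lambda>r f x. r * f x"
  using bounded_scaleR_comp by fastforce

instance
  by standard (transfer; simp add: algebra_simps fun_eq_iff)+

end

lemmas apply_linfty_simps [simp] =
  zero_linfty.rep_eq plus_linfty.rep_eq uminus_linfty.rep_eq minus_linfty.rep_eq
  scaleR_linfty.rep_eq

lemma bdd_above_abs_linfty: "bdd_above (range (\<lambda>x. \<bar>apply_linfty f x\<bar>))"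
proof -
  obtain b where "\<And>x. \<bar>apply_linfty f x\<bar> \<le> b"
    using bounded_apply_linfty[of f] by (auto simp: bounded_iff)
  then show ?thesis by (auto simp: bdd_above_def)
qed

instantiation linfty :: (type) real_normed_vector
begin

definition norm_linfty :: "'a linfty \<Rightarrow> real"
  where "norm_linfty f = (SUP x. \<bar>apply_linfty f x\<bar>)"

definition dist_linfty :: "'a linfty \<Rightarrow> 'a linfty \<Rightarrow> real"
  where "dist_linfty f g = norm (f - g)"

definition sgn_linfty :: "'a linfty \<Rightarrow> 'a linfty"
  where "sgn_linfty f = inverse (norm f) *\<^sub>R f"

definition uniformity_linfty :: "('a linfty \<times> 'a linfty) filter"
  where "uniformity_linfty = (INF e\<in>{0<..}. principal {(f, g). dist f g < e})"

definition open_linfty :: "'a linfty set \<Rightarrow> bool"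
  where "open_linfty U \<longleftrightarrow> (\<forall>f\<in>U. \<forall>\<^sub>F (f', g) in uniformity. f' = f \<longrightarrow> g \<in> U)"

lemma abs_le_norm_linfty: "\<bar>apply_linfty f x\<bar> \<le> norm f"
  unfolding norm_linfty_def by (rule cSUP_upper[OF UNIV_I bdd_above_abs_linfty])

lemma norm_linfty_le: "(\<And>x. \<bar>apply_linfty f x\<bar> \<le> b) \<Longrightarrow> norm f \<le> b"
  unfolding norm_linfty_def by (rule cSUP_least) auto

instance
proof
  fix f g :: "'a linfty" and r :: real
  have nonneg: "0 \<le> norm h" for h :: "'a linfty"
    using abs_le_norm_linfty[of h undefined] abs_ge_zero order_trans by blast
  show "(norm f = 0) = (f = 0)"
  proof
    assume "norm f = 0"
    then have "\<bar>apply_linfty f x\<bar> \<le> 0" for x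
      using abs_le_norm_linfty[of f x] by simp
    then show "f = 0"
      by (intro linfty_eqI) simp
  next
    assume "f = 0"
    then show "norm f = 0"
      by (simp add: norm_linfty_def)
  qed
  show "norm (f + g) \<le> norm f + norm g"
  proof (rule norm_linfty_le)
    fix x
    show "\<bar>apply_linfty (f + g) x\<bar> \<le> norm f + norm g"
      using abs_le_norm_linfty[of f x] abs_le_norm_linfty[of g x] by simp
  qed
  have le: "norm (s *\<^sub>R h) \<le> \<bar>s\<bar> * norm h" for s and h :: "'a linfty"
    by (rule norm_linfty_le) (simp add: abs_mult mult_left_mono abs_le_norm_linfty)
  show "norm (r *\<^sub>R f) = \<bar>r\<bar> * norm f"
  proof (cases "r = 0")
    case True
    then show ?thesis using le[of r f] nonneg[of "r *\<^sub>R f"] by simp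
  next
    case False
    have "norm f \<le> \<bar>inverse r\<bar> * norm (r *\<^sub>R f)"
      using le[of "inverse r" "r *\<^sub>R f"] False by simp
    then have "\<bar>r\<bar> * norm f \<le> norm (r *\<^sub>R f)"
      using False by (simp add: field_simps)
    with le[of r f] show ?thesis by simp
  qed
qed (rule dist_linfty_def sgn_linfty_def uniformity_linfty_def open_linfty_def)+

end

instance linfty :: (type) banach
proof
  fix X :: "nat \<Rightarrow> 'a linfty"
  assume X: "Cauchy X"
  have pw: "\<bar>apply_linfty (X m) x - apply_linfty (X n) x\<bar> \<le> dist (X m) (X n)" for m n x
    using abs_le_norm_linfty[of "X m - X n" x] by (simp add: dist_linfty_def)
  have "Cauchy (\<lambda>n. apply_linfty (X n) x)" for x
  proof (rule metric_CauchyI)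
    fix e :: real assume "0 < e"
    then obtain M where "\<forall>m\<ge>M. \<forall>n\<ge>M. dist (X m) (X n) < e"
      using metric_CauchyD[OF X] by blast
    then show "\<exists>M. \<forall>m\<ge>M. \<forall>n\<ge>M. dist (apply_linfty (X m) x) (apply_linfty (X n) x) < e"
      using pw[of _ x] by (metis dist_real_def order_le_less_trans)
  qed
  then have "\<exists>l. (\<lambda>n. apply_linfty (X n) x) \<longlonglongrightarrow> l" for x
    using Cauchy_convergent_iff convergent_def by blast
  then obtain L where L: "\<And>x. (\<lambda>n. apply_linfty (X n) x) \<longlonglongrightarrow> L x"
    by metis
  have unif: "\<exists>M. \<forall>n\<ge>M. \<forall>x. \<bar>apply_linfty (X n) x - L x\<bar> \<le> e" if e: "0 < e" for e
  proof -
    obtain M where M: "\<forall>m\<ge>M. \<forall>n\<ge>M. dist (X m) (X n) < e"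
      using metric_CauchyD[OF X e] by blast
    have "\<bar>apply_linfty (X n) x - L x\<bar> \<le> e" if "n \<ge> M" for n x
    proof (rule LIMSEQ_le_const2)
      show "(\<lambda>m. \<bar>apply_linfty (X n) x - apply_linfty (X m) x\<bar>) \<longlonglongrightarrow> \<bar>apply_linfty (X n) x - L x\<bar>"
        by (intro tendsto_intros L)
      show "\<exists>N. \<forall>m\<ge>N. \<bar>apply_linfty (X n) x - apply_linfty (X m) x\<bar> \<le> e"
        using M that pw[of n x] by (meson less_imp_le order_trans)
    qed
    then show ?thesis by blast
  qed
  obtain N where N: "\<And>x. \<bar>apply_linfty (X N) x - L x\<bar> \<le> 1"
    using unif[of 1] by auto
  have "\<bar>L x\<bar> \<le> norm (X N) + 1" for x
    using N[of x] abs_le_norm_linfty[of "X N" x] by linarith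
  then have "bounded (range L)"
    by (auto simp: bounded_iff)
  then have AL: "apply_linfty (Linfty L) = L"
    by (simp add: Linfty_inverse)
  have "X \<longlonglongrightarrow> Linfty L"
  proof (rule metric_LIMSEQ_I)
    fix e :: real assume "0 < e"
    then obtain M where M: "\<forall>n\<ge>M. \<forall>x. \<bar>apply_linfty (X n) x - L x\<bar> \<le> e / 2"
      using unif[of "e / 2"] by auto
    have "dist (X n) (Linfty L) \<le> e / 2" if "n \<ge> M" for n
      unfolding dist_linfty_def by (rule norm_linfty_le) (use M that AL in simp)
    with \<open>0 < e\<close> show "\<exists>M. \<forall>n\<ge>M. dist (X n) (Linfty L) < e"
      by (metis field_sum_of_halves less_add_same_cancel1 half_gt_zero order_le_less_trans)
  qed
  then show "convergent X"
    by (rule convergentI)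
qed

definition continuous_linfty :: "'a::topological_space linfty set"
  where "continuous_linfty = {f. continuous_on UNIV (apply_linfty f)}"


section \<open>Hadamard directional differentiability\<close>

text \<open>
  Here \<open>t \<down> 0\<close> means that all \<open>t n\<close> are positive and \<open>t\<close> tends to \<open>0\<close>; the sequence need not be
  monotone. The derivative is a map on \<open>D\<close> only, so its values outside \<open>D\<close> are irrelevant.
\<close>

definition has_hadamard_directional_derivative ::
    "('d::banach \<Rightarrow> 'e::banach) \<Rightarrow> ('d \<Rightarrow> 'e) \<Rightarrow> 'd \<Rightarrow> 'd set \<Rightarrow> bool"
  where "has_hadamard_directional_derivative \<phi> \<phi>' \<theta> D \<longleftrightarrow>
    (\<forall>h\<in>D. \<forall>(t :: nat \<Rightarrow> real) (k :: nat \<Rightarrow> 'd).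
       (\<forall>n. 0 < t n) \<longrightarrow> t \<longlonglongrightarrow> 0 \<longrightarrow> (\<lambda>n. norm (k n - h)) \<longlonglongrightarrow> 0 \<longrightarrow>
       (\<lambda>n. norm ((\<phi> (\<theta> + t n *\<^sub>R k n) - \<phi> \<theta>) /\<^sub>R t n - \<phi>' h)) \<longlonglongrightarrow> 0)"


section \<open>The functionals and the sets of (approximate) extremal points\<close>

definition sup_norm_map :: "'a linfty \<Rightarrow> real"
  where "sup_norm_map f = norm f"

definition sup_map :: "'a linfty \<Rightarrow> real"
  where "sup_map f = (SUP x. apply_linfty f x)"

definition inf_map :: "'a linfty \<Rightarrow> real"
  where "inf_map f = (INF x. apply_linfty f x)"

definition amplitude_map :: "'a linfty \<Rightarrow> real"
  where "amplitude_map f = (SUP x. apply_linfty f x) - (INF x. apply_linfty f x)"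

text \<open>
  The following sets are defined for arbitrary real functions, so that they apply to \<open>\<bar>f\<bar>\<close>
  directly; they are meaningful for bounded functions only.
\<close>

definition A0 :: "('a::metric_space \<Rightarrow> real) \<Rightarrow> 'a set"
  where "A0 h = {x. \<exists>X :: nat \<Rightarrow> 'a. X \<longlonglongrightarrow> x \<and> (\<lambda>n. h (X n)) \<longlonglongrightarrow> (SUP y. h y)}"

definition B0 :: "('a::metric_space \<Rightarrow> real) \<Rightarrow> 'a set"
  where "B0 h = {x. \<exists>X :: nat \<Rightarrow> 'a. X \<longlonglongrightarrow> x \<and> (\<lambda>n. h (X n)) \<longlonglongrightarrow> (INF y. h y)}"

definition M_plus :: "('a \<Rightarrow> real) \<Rightarrow> 'a set"
  where "M_plus h = {x. h x = (SUP y. h y)}"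

definition M_minus :: "('a \<Rightarrow> real) \<Rightarrow> 'a set"
  where "M_minus h = {x. h x = (INF y. h y)}"

end

theory Submission
  imports Defs
begin

text \<open>
  The difference quotient of the supremum only sees the near-maximisers of \<open>f\<close>: it converges to \<open>L\<close>
  as soon as \<open>g\<close> is at most about \<open>L\<close> on \<open>{f > sup f - \<eta>}\<close> for small \<open>\<eta>\<close>, while values close to
  \<open>L\<close> are attained on each of these sets. This criterion involves no topology on the
  domain; compactness and continuity of \<open>g\<close> yield it with \<open>L = sup g\<close> over \<open>A0 f\<close>. The infimum is reduced to
  the supremum by \<open>f \<mapsto> -f\<close>, and the norm by viewing \<open>\<parallel>f\<parallel>\<close> as the supremum of
  \<open>(x, s) \<mapsto> s f(x)\<close> over points \<open>x\<close> and signs \<open>s\<close>.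
\<close>

section \<open>Calculus of directional derivatives: differences and reflection\<close>

lemma has_hadamard_directional_derivative_iff:
  "has_hadamard_directional_derivative \<phi> \<phi>' \<theta> D \<longleftrightarrow>
    (\<forall>h\<in>D. \<forall>t k. (\<forall>n. 0 < t n) \<longrightarrow> t \<longlonglongrightarrow> 0 \<longrightarrow> k \<longlonglongrightarrow> h \<longrightarrow>
       (\<lambda>n. (\<phi> (\<theta> + t n *\<^sub>R k n) - \<phi> \<theta>) /\<^sub>R t n) \<longlonglongrightarrow> \<phi>' h)"
  unfolding has_hadamard_directional_derivative_def tendsto_norm_zero_iff
  by (simp only: LIM_zero_iff)

lemma has_hadamard_directional_derivative_diff:
  assumes "has_hadamard_directional_derivative \<phi> \<phi>' \<theta> D"
    and "has_hadamard_directional_derivative \<psi> \<psi>' \<theta> D"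
  shows "has_hadamard_directional_derivative (\<lambda>f. \<phi> f - \<psi> f) (\<lambda>g. \<phi>' g - \<psi>' g) \<theta> D"
  unfolding has_hadamard_directional_derivative_iff
proof (intro ballI allI impI)
  fix h and t :: "nat \<Rightarrow> real" and k
  assume *: "h \<in> D" "\<forall>n. 0 < t n" "t \<longlonglongrightarrow> 0" "k \<longlonglongrightarrow> h"
  have "(\<lambda>n. (\<phi> (\<theta> + t n *\<^sub>R k n) - \<phi> \<theta>) /\<^sub>R t n - (\<psi> (\<theta> + t n *\<^sub>R k n) - \<psi> \<theta>) /\<^sub>R t n)
      \<longlonglongrightarrow> \<phi>' h - \<psi>' h"
    using assms * unfolding has_hadamard_directional_derivative_iff
    by (intro tendsto_diff) auto
  then show "(\<lambda>n. (\<phi> (\<theta> + t n *\<^sub>R k n) - \<psi> (\<theta> + t n *\<^sub>R k n) - (\<phi> \<theta> - \<psi> \<theta>)) /\<^sub>R t n)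
      \<longlonglongrightarrow> \<phi>' h - \<psi>' h"
    by (simp add: algebra_simps)
qed

text \<open>An increment \<open>k n\<close> at \<open>\<theta>\<close> is the increment
  \<open>- k n\<close> at \<open>- \<theta>\<close>, and symmetry of \<open>D\<close> keeps the
  limiting direction admissible. With \<open>\<phi> = sup_map\<close> this yields the
  infimum.\<close>

lemma has_hadamard_directional_derivative_reflect:
  assumes "has_hadamard_directional_derivative \<phi> \<phi>' (- \<theta>) D"
    and "\<And>h. h \<in> D \<Longrightarrow> - h \<in> D"
  shows "has_hadamard_directional_derivative (\<lambda>f. - \<phi> (- f)) (\<lambda>g. - \<phi>' (- g)) \<theta> D"
  unfolding has_hadamard_directional_derivative_iff
proof (intro ballI allI impI)
  fix h and t :: "nat \<Rightarrow> real" and k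
  assume *: "h \<in> D" "\<forall>n. 0 < t n" "t \<longlonglongrightarrow> 0" "k \<longlonglongrightarrow> h"
  have "(\<lambda>n. - k n) \<longlonglongrightarrow> - h"
    using *(4) by (rule tendsto_minus)
  then have "(\<lambda>n. (\<phi> (- \<theta> + t n *\<^sub>R - k n) - \<phi> (- \<theta>)) /\<^sub>R t n) \<longlonglongrightarrow> \<phi>' (- h)"
    using assms(1) assms(2)[OF *(1)] *(2,3)
    unfolding has_hadamard_directional_derivative_iff by blast
  then have "(\<lambda>n. - ((\<phi> (- \<theta> + t n *\<^sub>R - k n) - \<phi> (- \<theta>)) /\<^sub>R t n)) \<longlonglongrightarrow> - \<phi>' (- h)"
    by (rule tendsto_minus)
  then show "(\<lambda>n. (- \<phi> (- (\<theta> + t n *\<^sub>R k n)) - - \<phi> (- \<theta>)) /\<^sub>R t n) \<longlonglongrightarrow> - \<phi>' (- h)"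
    by (simp add: algebra_simps)
qed

section \<open>The supremum: limit criterion, then compactness\<close>

lemma bdd_above_linfty: "bdd_above (apply_linfty f ` S)"
  using abs_le_norm_linfty[of f] by (intro bdd_aboveI2[of _ _ "norm f"]) (metis abs_le_iff)

lemma apply_linfty_le_sup_map: "apply_linfty f x \<le> sup_map f"
  unfolding sup_map_def by (intro cSUP_upper bdd_above_linfty) simp

lemma sup_map_le: "(\<And>x. apply_linfty f x \<le> b) \<Longrightarrow> sup_map f \<le> b"
  unfolding sup_map_def by (intro cSUP_least) auto

text \<open>Upper bound: near-maximisers gain at most about \<open>t n * L\<close>, while all other
  points start \<open>\<eta>\<close> too low to catch up once \<open>t n\<close> is small. Lower
  bound: evaluate the perturbed function at a single near-maximiser where \<open>g\<close> is almost
  \<open>L\<close>.\<close>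

lemma sup_map_directional_limit:
  assumes t: "\<And>n. 0 < t n" "t \<longlonglongrightarrow> 0" and k: "k \<longlonglongrightarrow> g"
    and le: "\<And>e. 0 < e \<Longrightarrow>
      \<exists>\<eta>>0. \<forall>y. sup_map f - \<eta> < apply_linfty f y \<longrightarrow> apply_linfty g y < L + e"
    and ge: "\<And>e \<eta>. 0 < e \<Longrightarrow> 0 < \<eta> \<Longrightarrow>
      \<exists>y. sup_map f - \<eta> < apply_linfty f y \<and> L - e < apply_linfty g y"
  shows "(\<lambda>n. (sup_map (f + t n *\<^sub>R k n) - sup_map f) /\<^sub>R t n) \<longlonglongrightarrow> L"
proof (rule tendstoI)
  fix e :: real
  assume "0 < e"
  \<comment> \<open>One \<open>d\<close> pays for the slack in \<open>le\<close> and
    \<open>ge\<close>, a second for replacing \<open>g\<close> by \<open>k n\<close>; the total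
    error \<open>2 * d\<close> stays strictly below \<open>e\<close>.\<close>
  define d where "d = e / 3"
  have d: "0 < d"
    using \<open>0 < e\<close> by (simp add: d_def)
  obtain \<eta> where \<eta>: "0 < \<eta>"
    "\<And>y. sup_map f - \<eta> < apply_linfty f y \<Longrightarrow> apply_linfty g y < L + d"
    using le[OF d] by blast
  \<comment> \<open>Off the near-maximisers the perturbation adds at most
    \<open>t n * (norm g + d)\<close>. This limit makes its excess over \<open>t n * L\<close>
    smaller than the deficit \<open>\<eta>\<close>.\<close>
  have "(\<lambda>n. t n * (norm g + d - L)) \<longlonglongrightarrow> 0 * (norm g + d - L)"
    by (intro tendsto_intros t)
  then have "\<forall>\<^sub>F n in sequentially. t n * (norm g + d - L) < \<eta>"
    using \<eta>(1) by (auto dest: order_tendstoD(2))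
  moreover have "\<forall>\<^sub>F n in sequentially. dist (k n) g < d"
    using k d by (rule tendstoD)
  ultimately show "\<forall>\<^sub>F n in sequentially.
      dist ((sup_map (f + t n *\<^sub>R k n) - sup_map f) /\<^sub>R t n) L < e"
  proof eventually_elim
    case (elim n)
    let ?q = "sup_map (f + t n *\<^sub>R k n)"
    have close: "\<bar>apply_linfty (k n) y - apply_linfty g y\<bar> \<le> d" for y
      using abs_le_norm_linfty[of "k n - g" y] elim(2) by (simp add: dist_norm)
    have "?q \<le> sup_map f + t n * (L + 2 * d)"
    proof (rule sup_map_le)
      fix y
      show "apply_linfty (f + t n *\<^sub>R k n) y \<le> sup_map f + t n * (L + 2 * d)"
      proof (cases "sup_map f - \<eta> < apply_linfty f y")
        case True
        then have "apply_linfty (k n) y \<le> L + 2 * d"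
          using \<eta>(2)[OF True] close[of y] by linarith
        then have "t n * apply_linfty (k n) y \<le> t n * (L + 2 * d)"
          using t(1)[of n] by (simp add: mult_left_mono)
        then show ?thesis
          using apply_linfty_le_sup_map[of f y] by simp
      next
        case False
        have "apply_linfty (k n) y \<le> norm g + d"
          using abs_le_norm_linfty[of g y] close[of y] by linarith
        then have "t n * apply_linfty (k n) y \<le> t n * (norm g + d)"
          using t(1)[of n] by (simp add: mult_left_mono)
        moreover have "0 < t n * d"
          using t(1) d by simp
        ultimately show ?thesis
          using False elim(1) by (simp add: algebra_simps)
      qed
    qed
    moreover have "sup_map f + t n * (L - 2 * d) \<le> ?q"
    \<comment> \<open>Here \<open>n\<close> is fixed and \<open>\<epsilon>\<close> takes the place
      of the \<open>\<eta>\<close> in \<open>ge\<close>, so the loss in \<open>f\<close> at the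
      chosen point can be made arbitrarily small even compared with \<open>t n\<close>.\<close>
    proof (rule field_le_epsilon)
      fix \<epsilon> :: real
      assume "0 < \<epsilon>"
      then obtain y where y: "sup_map f - \<epsilon> < apply_linfty f y" "L - d < apply_linfty g y"
        using ge[OF d] by blast
      have "L - 2 * d \<le> apply_linfty (k n) y"
        using y(2) close[of y] by linarith
      then have "t n * (L - 2 * d) \<le> t n * apply_linfty (k n) y"
        using t(1)[of n] by (simp add: mult_left_mono)
      then show "sup_map f + t n * (L - 2 * d) \<le> ?q + \<epsilon>"
        using y(1) apply_linfty_le_sup_map[of "f + t n *\<^sub>R k n" y] by simp
    qed
    ultimately have "(?q - sup_map f) / t n \<le> L + 2 * d" "L - 2 * d \<le> (?q - sup_map f) / t n"
      using t(1)[of n] by (simp_all add: pos_divide_le_eq pos_le_divide_eq mult.commute)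
    then have "\<bar>(?q - sup_map f) / t n - L\<bar> < e"
      using \<open>0 < e\<close> unfolding d_def by linarith
    then show ?case
      by (simp only: dist_real_def real_scaleR_def divide_inverse_commute)
  qed
qed

text \<open>Were there no such \<open>\<eta>\<close>, points with \<open>F\<close> within 1/(n+1) of
  \<open>S\<close> and \<open>c \<le> G\<close> would accumulate, by compactness, at some
  \<open>x\<close>. Then \<open>F\<close> tends to \<open>S\<close> along a sequence converging to
  \<open>x\<close>, while continuity gives \<open>c \<le> G x\<close>. Keeping \<open>F\<close>,
  \<open>S\<close> and \<open>c\<close> general serves the supremum, the nonemptiness of
  \<open>A0\<close> and both signs in the norm.\<close>

lemma less_on_near_maximisers:
  fixes F G :: "'a::metric_space \<Rightarrow> real"
  assumes "compact (UNIV :: 'a set)" and cont: "continuous_on UNIV G"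
    and le: "\<And>x. F x \<le> S"
    and lim: "\<And>x X. X \<longlonglongrightarrow> x \<Longrightarrow> (\<lambda>n. F (X n)) \<longlonglongrightarrow> S \<Longrightarrow> G x < c"
  shows "\<exists>\<eta>>0. \<forall>y. S - \<eta> < F y \<longrightarrow> G y < c"
proof (rule ccontr)
  assume *: "\<not> ?thesis"
  have "\<exists>y. S - inverse (real (Suc n)) < F y \<and> c \<le> G y" for n
    using * by (metis inverse_positive_iff_positive not_less of_nat_0_less_iff zero_less_Suc)
  then obtain Y where Y: "\<And>n. S - inverse (real (Suc n)) < F (Y n)" "\<And>n. c \<le> G (Y n)"
    by metis
  obtain x r where r: "strict_mono r" and x: "(Y \<circ> r) \<longlonglongrightarrow> x"
    using assms(1) unfolding compact_def by (metis UNIV_I)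
  have "(\<lambda>n. S - inverse (real (Suc n))) \<longlonglongrightarrow> S"
    using tendsto_diff[OF tendsto_const LIMSEQ_inverse_real_of_nat] by force
  then have "(\<lambda>n. F (Y n)) \<longlonglongrightarrow> S"
    by (rule tendsto_sandwich[OF always_eventually always_eventually _ tendsto_const, rotated 2])
      (use Y(1) le in \<open>blast intro: less_imp_le\<close>)+
  then have "(\<lambda>n. F ((Y \<circ> r) n)) \<longlonglongrightarrow> S"
    using LIMSEQ_subseq_LIMSEQ[of "\<lambda>n. F (Y n)", OF _ r] by (simp only: o_def)
  then have "G x < c"
    using lim x by blast
  moreover have "(\<lambda>n. G ((Y \<circ> r) n)) \<longlonglongrightarrow> G x"
    using continuous_on_tendsto_compose[OF cont x] by simp
  then have "c \<le> G x"
    by (rule LIMSEQ_le_const) (use Y(2) in auto)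
  ultimately show False
    by simp
qed

lemma A0_nonempty:
  assumes "compact (UNIV :: 'a::metric_space set)"
  shows "A0 (apply_linfty (f :: 'a linfty)) \<noteq> {}"
proof
  assume "A0 (apply_linfty f) = {}"
  \<comment> \<open>With \<open>A0\<close> empty the limit hypothesis is vacuous, so the previous
    lemma applies to the constant function 0 with the absurd bound \<open>c = 0\<close>. No value of
    \<open>f\<close> then exceeds \<open>sup_map f - \<eta>\<close>.\<close>
  then have "\<exists>\<eta>>0. \<forall>y. sup_map f - \<eta> < apply_linfty f y \<longrightarrow> (0 :: real) < 0"
    by (intro less_on_near_maximisers assms apply_linfty_le_sup_map)
      (auto simp: A0_def sup_map_def)
  then obtain \<eta> where \<eta>: "0 < \<eta>" "\<And>y. apply_linfty f y \<le> sup_map f - \<eta>"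
    by (auto simp: not_less)
  then have "sup_map f \<le> sup_map f - \<eta>"
    by (intro sup_map_le)
  with \<eta>(1) show False
    by simp
qed

lemma sup_map_hadamard:
  fixes f :: "'a::metric_space linfty"
  assumes comp: "compact (UNIV :: 'a set)"
  shows "has_hadamard_directional_derivative sup_map
    (\<lambda>g. SUP x\<in>A0 (apply_linfty f). apply_linfty g x) f continuous_linfty"
  unfolding has_hadamard_directional_derivative_iff
proof (intro ballI allI impI)
  fix g :: "'a linfty" and t :: "nat \<Rightarrow> real" and k
  assume g: "g \<in> continuous_linfty" and tk: "\<forall>n. 0 < t n" "t \<longlonglongrightarrow> 0" "k \<longlonglongrightarrow> g"
  let ?A = "A0 (apply_linfty f)"
  let ?L = "SUP x\<in>?A. apply_linfty g x"
  have cont: "continuous_on UNIV (apply_linfty g)"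
    using g by (simp add: continuous_linfty_def)
  show "(\<lambda>n. (sup_map (f + t n *\<^sub>R k n) - sup_map f) /\<^sub>R t n) \<longlonglongrightarrow> ?L"
  proof (rule sup_map_directional_limit)
    fix e :: real
    assume "0 < e"
    show "\<exists>\<eta>>0. \<forall>y. sup_map f - \<eta> < apply_linfty f y \<longrightarrow> apply_linfty g y < ?L + e"
    proof (rule less_on_near_maximisers[OF comp cont apply_linfty_le_sup_map])
      fix x X
      assume "X \<longlonglongrightarrow> x" "(\<lambda>n. apply_linfty f (X n)) \<longlonglongrightarrow> sup_map f"
      then have "x \<in> ?A"
        by (auto simp: A0_def sup_map_def)
      then have "apply_linfty g x \<le> ?L"
        by (intro cSUP_upper bdd_above_linfty)
      with \<open>0 < e\<close> show "apply_linfty g x < ?L + e"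
        by simp
    qed
  next
    fix e \<eta> :: real
    assume "0 < e" "0 < \<eta>"
    then obtain x where x: "x \<in> ?A" "?L - e < apply_linfty g x"
      using less_cSUP_iff[OF A0_nonempty[OF comp] bdd_above_linfty, of "?L - e" g f] by auto
    \<comment> \<open>The value of \<open>f\<close> at \<open>x\<close> itself may lie far below its
      supremum when \<open>f\<close> is discontinuous. The required point is therefore taken from a
      sequence witnessing \<open>x \<in> ?A\<close>, along which continuity keeps \<open>g\<close>
      near its value at \<open>x\<close>.\<close>
    then obtain X where X: "X \<longlonglongrightarrow> x" "(\<lambda>n. apply_linfty f (X n)) \<longlonglongrightarrow> sup_map f"
      by (auto simp: A0_def sup_map_def)
    have "(\<lambda>n. apply_linfty g (X n)) \<longlonglongrightarrow> apply_linfty g x"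
      using continuous_on_tendsto_compose[OF cont X(1)] by simp
    then have "\<forall>\<^sub>F n in sequentially. ?L - e < apply_linfty g (X n)"
      using x(2) by (rule order_tendstoD)
    moreover have "\<forall>\<^sub>F n in sequentially. sup_map f - \<eta> < apply_linfty f (X n)"
      using X(2) \<open>0 < \<eta>\<close> by (intro order_tendstoD) auto
    ultimately have "\<forall>\<^sub>F n in sequentially.
        sup_map f - \<eta> < apply_linfty f (X n) \<and> ?L - e < apply_linfty g (X n)"
      by eventually_elim simp
    then show "\<exists>y. sup_map f - \<eta> < apply_linfty f y \<and> ?L - e < apply_linfty g y"
      using eventually_happens'[OF sequentially_bot] by fast
  qed (use tk in auto)
qed

section \<open>The infimum and the amplitude by reflection\<close>

lemma Inf_image_eq_minus_Sup: "(INF x\<in>S. h x) = - (SUP x\<in>S. - h x :: real)"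
  \<comment> \<open>On the reals \<open>Inf\<close> is defined through \<open>Sup\<close> of the
    negatives, so the identity also covers empty and unbounded images.\<close>
  by (simp add: Inf_real_def image_image)

lemma inf_map_eq_sup_map: "inf_map f = - sup_map (- f)"
  by (simp add: inf_map_def sup_map_def Inf_image_eq_minus_Sup)

lemma B0_eq_A0_uminus: "B0 (apply_linfty f) = A0 (apply_linfty (- f))"
proof -
  have "(\<lambda>n. apply_linfty f (X n)) \<longlonglongrightarrow> (INF y. apply_linfty f y) \<longleftrightarrow>
      (\<lambda>n. - apply_linfty f (X n)) \<longlonglongrightarrow> (SUP y. - apply_linfty f y)" for X :: "nat \<Rightarrow> 'a"
    using tendsto_minus_cancel_left[of "\<lambda>n. apply_linfty f (X n)" "SUP y. - apply_linfty f y" sequentially]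
    by (simp add: Inf_image_eq_minus_Sup)
  then show ?thesis
    by (simp add: A0_def B0_def)
qed

lemma inf_map_hadamard:
  fixes f :: "'a::metric_space linfty"
  assumes "compact (UNIV :: 'a set)"
  shows "has_hadamard_directional_derivative inf_map
    (\<lambda>g. INF x\<in>B0 (apply_linfty f). apply_linfty g x) f continuous_linfty"
proof -
  have "has_hadamard_directional_derivative (\<lambda>f. - sup_map (- f))
      (\<lambda>g. - (SUP x\<in>A0 (apply_linfty (- f)). apply_linfty (- g) x)) f continuous_linfty"
    by (rule has_hadamard_directional_derivative_reflect[OF sup_map_hadamard[OF assms]])
      (auto simp: continuous_linfty_def intro: continuous_on_minus)
  then show ?thesis
    unfolding inf_map_eq_sup_map[abs_def] B0_eq_A0_uminus by (simp add: Inf_image_eq_minus_Sup)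
qed

lemma amplitude_map_hadamard:
  fixes f :: "'a::metric_space linfty"
  assumes "compact (UNIV :: 'a set)"
  shows "has_hadamard_directional_derivative amplitude_map
    (\<lambda>g. (SUP x\<in>A0 (apply_linfty f). apply_linfty g x)
        - (INF x\<in>B0 (apply_linfty f). apply_linfty g x)) f continuous_linfty"
  using has_hadamard_directional_derivative_diff[OF sup_map_hadamard inf_map_hadamard, OF assms assms]
  by (simp add: amplitude_map_def[abs_def] sup_map_def inf_map_def)

section \<open>Continuous functions: approximate extremal points are extremal\<close>

lemma A0_eq_M_plus:
  assumes "continuous_on UNIV h"
  shows "A0 h = M_plus h"
proof (rule set_eqI)
  fix x
  show "x \<in> A0 h \<longleftrightarrow> x \<in> M_plus h"
  proof
    assume "x \<in> A0 h"
    then obtain X where X: "X \<longlonglongrightarrow> x" "(\<lambda>n. h (X n)) \<longlonglongrightarrow> (SUP y. h y)"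
      by (auto simp: A0_def)
    have "(\<lambda>n. h (X n)) \<longlonglongrightarrow> h x"
      using continuous_on_tendsto_compose[OF assms X(1)] by simp
    then show "x \<in> M_plus h"
      using X(2) LIMSEQ_unique by (auto simp: M_plus_def)
  next
    assume "x \<in> M_plus h"
    then show "x \<in> A0 h"
      by (auto simp: A0_def M_plus_def intro!: exI[of _ "\<lambda>_. x"])
  qed
qed

lemma B0_eq_M_minus:
  assumes "continuous_on UNIV (apply_linfty f)"
  shows "B0 (apply_linfty f) = M_minus (apply_linfty f)"
proof -
  have "A0 (apply_linfty (- f)) = M_plus (apply_linfty (- f))"
    using assms by (intro A0_eq_M_plus) (simp add: continuous_on_minus)
  also have "\<dots> = M_minus (apply_linfty f)"
    by (auto simp: M_plus_def M_minus_def Inf_image_eq_minus_Sup)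
  finally show ?thesis
    by (simp only: B0_eq_A0_uminus)
qed

section \<open>The norm as a supremum over signed points\<close>

lift_definition signed :: "'a linfty \<Rightarrow> ('a \<times> bool) linfty"
  is "\<lambda>f (x, s). if s then f x else - f x"
  by (fastforce simp: bounded_iff)

text \<open>Used with \<open>c = t n\<close> to carry the perturbed function to the signed side, and
  with \<open>c = -1\<close> to turn preservation of norms into preservation of distances.\<close>

lemma signed_linear: "signed (f + c *\<^sub>R g) = signed f + c *\<^sub>R signed g"
  by (rule linfty_eqI) (auto simp: signed.rep_eq)

lemma abs_apply_signed [simp]: "\<bar>apply_linfty (signed f) (x, s)\<bar> = \<bar>apply_linfty f x\<bar>"
  by (simp add: signed.rep_eq)

lemma norm_signed: "norm (signed f) = norm f"
proof (rule antisym)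
  show "norm (signed f) \<le> norm f"
    by (rule norm_linfty_le) (auto simp: abs_le_norm_linfty)
  show "norm f \<le> norm (signed f)"
    by (rule norm_linfty_le) (metis abs_apply_signed abs_le_norm_linfty)
qed

lemma tendsto_signed:
  assumes "k \<longlonglongrightarrow> g"
  shows "(\<lambda>n. signed (k n)) \<longlonglongrightarrow> signed g"
proof -
  have "dist (signed a) (signed b) = dist a b" for a b :: "'a linfty"
    using norm_signed[of "a - b"] signed_linear[of a "-1" b] by (simp add: dist_norm)
  with assms show ?thesis
    by (simp add: tendsto_iff)
qed

lemma sup_norm_map_eq_sup_map: "sup_norm_map f = sup_map (signed f)"
proof (rule antisym)
  show "sup_norm_map f \<le> sup_map (signed f)"
    unfolding sup_norm_map_def
  proof (rule norm_linfty_le)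
    fix x
    show "\<bar>apply_linfty f x\<bar> \<le> sup_map (signed f)"
      using apply_linfty_le_sup_map[of "signed f" "(x, True)"]
        apply_linfty_le_sup_map[of "signed f" "(x, False)"]
      by (simp add: signed.rep_eq abs_le_iff)
  qed
  show "sup_map (signed f) \<le> sup_norm_map f"
    unfolding sup_norm_map_def norm_signed[of f, symmetric]
    by (rule sup_map_le) (metis abs_le_norm_linfty abs_le_iff)
qed

text \<open>The limit criterion is applied to \<open>signed f\<close> in direction
  \<open>signed g\<close>. Near-maximisers are pairs of a point and a sign \<open>s\<close> with
  \<open>s * f\<close> close to \<open>norm f\<close>; at their limit points \<open>s\<close> is the
  sign of \<open>f\<close>, which produces the factor \<open>sgn\<close>.\<close>

lemma sup_norm_map_hadamard:
  fixes f :: "'a::metric_space linfty"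
  assumes comp: "compact (UNIV :: 'a set)" and f: "f \<in> continuous_linfty" "f \<noteq> 0"
  shows "has_hadamard_directional_derivative sup_norm_map
    (\<lambda>g. SUP x\<in>M_plus (\<lambda>y. \<bar>apply_linfty f y\<bar>). apply_linfty g x * sgn (apply_linfty f x))
    f continuous_linfty"
  unfolding has_hadamard_directional_derivative_iff
proof (intro ballI allI impI)
  fix g :: "'a linfty" and t :: "nat \<Rightarrow> real" and k
  assume g: "g \<in> continuous_linfty" and tk: "\<forall>n. 0 < t n" "t \<longlonglongrightarrow> 0" "k \<longlonglongrightarrow> g"
  let ?M = "M_plus (\<lambda>y. \<bar>apply_linfty f y\<bar>)"
  let ?G = "\<lambda>x. apply_linfty g x * sgn (apply_linfty f x)"
  let ?L = "SUP x\<in>?M. ?G x"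
  have contf: "continuous_on UNIV (apply_linfty f)" and contg: "continuous_on UNIV (apply_linfty g)"
    using f(1) g by (simp_all add: continuous_linfty_def)
  have S: "sup_map (signed f) = norm f"
    by (simp add: sup_norm_map_eq_sup_map[symmetric] sup_norm_map_def)
  have M: "x \<in> ?M \<longleftrightarrow> \<bar>apply_linfty f x\<bar> = norm f" for x
    by (simp add: M_plus_def norm_linfty_def)
  have bdd: "bdd_above (?G ` ?M)"
  proof (rule bdd_aboveI2)
    fix x
    show "?G x \<le> norm g"
      using abs_le_norm_linfty[of g x] by (auto simp: sgn_if abs_le_iff)
  qed
  \<comment> \<open>Attainment of the maximum makes \<open>?M\<close> nonempty, so that
    \<open>?L\<close> is a genuine supremum and can be approached from within
    \<open>?M\<close>.\<close>
  have "\<exists>x. \<forall>y. \<bar>apply_linfty f y\<bar> \<le> \<bar>apply_linfty f x\<bar>"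
    using continuous_attains_sup[OF comp _ continuous_on_rabs[OF contf]] by auto
  then obtain z where "\<And>y. \<bar>apply_linfty f y\<bar> \<le> \<bar>apply_linfty f z\<bar>"
    by blast
  then have "z \<in> ?M"
    unfolding M by (intro antisym norm_linfty_le abs_le_norm_linfty)
  then have ne: "?M \<noteq> {}"
    by blast
  \<comment> \<open>Fixing the sign \<open>s\<close> reduces the question to the compact space
    \<open>'a\<close>, where the compactness lemma applies to \<open>s * f\<close> and
    \<open>s * g\<close>.\<close>
  have near: "\<exists>\<eta>>0. \<forall>y. norm f - \<eta> < s * apply_linfty f y \<longrightarrow> s * apply_linfty g y < ?L + e"
    if "0 < e" and s: "s = 1 \<or> s = - 1" for e s :: real
  proof (rule less_on_near_maximisers[OF comp])
    show "continuous_on UNIV (\<lambda>y. s * apply_linfty g y)"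
      by (intro continuous_intros contg)
    show "s * apply_linfty f x \<le> norm f" for x
      using s abs_le_norm_linfty[of f x] by auto
    fix x X
    assume X: "X \<longlonglongrightarrow> x" "(\<lambda>n. s * apply_linfty f (X n)) \<longlonglongrightarrow> norm f"
    have "(\<lambda>n. s * apply_linfty f (X n)) \<longlonglongrightarrow> s * apply_linfty f x"
      using continuous_on_tendsto_compose[OF contf X(1)] by (intro tendsto_intros) simp
    then have eq: "s * apply_linfty f x = norm f"
      using X(2) LIMSEQ_unique by blast
    \<comment> \<open>This is where \<open>f \<noteq> 0\<close> enters:
      \<open>s * f x = norm f\<close> determines \<open>s\<close> as the sign of \<open>f x\<close>
      only when the norm is positive.\<close>
    have pos: "0 < norm f"
      using f(2) by simp
    have "\<bar>s * apply_linfty f x\<bar> = norm f"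
      unfolding eq by simp
    then have "x \<in> ?M"
      unfolding M using s by auto
    moreover have "s = sgn (apply_linfty f x)"
      using s eq pos by (auto simp: sgn_if simp del: zero_less_norm_iff)
    ultimately have "s * apply_linfty g x \<le> ?L"
      using cSUP_upper[OF _ bdd, of x] by (simp add: mult.commute)
    with \<open>0 < e\<close> show "s * apply_linfty g x < ?L + e"
      by simp
  qed
  have "(\<lambda>n. (sup_map (signed f + t n *\<^sub>R signed (k n)) - sup_map (signed f)) /\<^sub>R t n) \<longlonglongrightarrow> ?L"
  proof (rule sup_map_directional_limit[OF _ _ tendsto_signed[OF tk(3)]])
    fix e :: real
    assume "0 < e"
    obtain a where a: "0 < a"
      "\<And>y. norm f - a < apply_linfty f y \<Longrightarrow> apply_linfty g y < ?L + e"
      using near[OF \<open>0 < e\<close>, of 1] by auto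
    obtain b where b: "0 < b"
      "\<And>y. norm f - b < - apply_linfty f y \<Longrightarrow> - apply_linfty g y < ?L + e"
      using near[OF \<open>0 < e\<close>, of "- 1"] by auto
    show "\<exists>\<eta>>0. \<forall>y. sup_map (signed f) - \<eta> < apply_linfty (signed f) y \<longrightarrow>
        apply_linfty (signed g) y < ?L + e"
      \<comment> \<open>A point of the signed space carries either sign, so the smaller of the two
        thresholds is taken.\<close>
      using a b by (intro exI[of _ "min a b"]) (auto simp: S signed.rep_eq)
  next
    fix e \<eta> :: real
    assume "0 < e" "0 < \<eta>"
    then obtain x where x: "x \<in> ?M" "?L - e < ?G x"
      using less_cSUP_iff[OF ne bdd, of "?L - e"] by auto
    \<comment> \<open>Since \<open>f x\<close> is nonzero, the flag \<open>0 < f x\<close> selects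
      its sign. The pair of \<open>x\<close> and this flag attains \<open>norm f\<close> exactly,
      hence works for every \<open>\<eta>\<close>.\<close>
    have "apply_linfty f x \<noteq> 0"
      using x(1) f(2) unfolding M by auto
    then have "apply_linfty (signed g) (x, 0 < apply_linfty f x) = ?G x"
      and "apply_linfty (signed f) (x, 0 < apply_linfty f x) = norm f"
      using x(1) unfolding M by (auto simp: signed.rep_eq sgn_if)
    with x(2) \<open>0 < \<eta>\<close> show "\<exists>y. sup_map (signed f) - \<eta> < apply_linfty (signed f) y \<and>
        ?L - e < apply_linfty (signed g) y"
      by (intro exI[of _ "(x, 0 < apply_linfty f x)"]) (simp add: S)
  qed (use tk in auto)
  then show "(\<lambda>n. (sup_norm_map (f + t n *\<^sub>R k n) - sup_norm_map f) /\<^sub>R t n) \<longlonglongrightarrow> ?L"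
    by (simp add: sup_norm_map_eq_sup_map signed_linear)
qed

theorem corollary2p3:
  fixes f :: "'a::metric_space linfty"
  assumes "compact (UNIV :: 'a set)"
  shows
    "(has_hadamard_directional_derivative sup_map
        (\<lambda>g. SUP x\<in>A0 (apply_linfty f). apply_linfty g x) f continuous_linfty \<and>
      has_hadamard_directional_derivative inf_map
        (\<lambda>g. INF x\<in>B0 (apply_linfty f). apply_linfty g x) f continuous_linfty \<and>
      has_hadamard_directional_derivative amplitude_map
        (\<lambda>g. (SUP x\<in>A0 (apply_linfty f). apply_linfty g x)
            - (INF x\<in>B0 (apply_linfty f). apply_linfty g x)) f continuous_linfty) \<and>
     (f \<in> continuous_linfty - {0} \<longrightarrow>
      has_hadamard_directional_derivative sup_norm_map
        (\<lambda>g. SUP x\<in>M_plus (\<lambda>y. \<bar>apply_linfty f y\<bar>). apply_linfty g x * sgn (apply_linfty f x))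
        f continuous_linfty \<and>
      has_hadamard_directional_derivative sup_map
        (\<lambda>g. SUP x\<in>M_plus (apply_linfty f). apply_linfty g x) f continuous_linfty \<and>
      has_hadamard_directional_derivative inf_map
        (\<lambda>g. INF x\<in>M_minus (apply_linfty f). apply_linfty g x) f continuous_linfty \<and>
      has_hadamard_directional_derivative amplitude_map
        (\<lambda>g. (SUP x\<in>M_plus (apply_linfty f). apply_linfty g x)
            - (INF x\<in>M_minus (apply_linfty f). apply_linfty g x)) f continuous_linfty)"
proof (intro conjI impI)
  note main = sup_map_hadamard[OF assms] inf_map_hadamard[OF assms] amplitude_map_hadamard[OF assms]
  show "has_hadamard_directional_derivative sup_map
      (\<lambda>g. SUP x\<in>A0 (apply_linfty f). apply_linfty g x) f continuous_linfty"
    and "has_hadamard_directional_derivative inf_map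
      (\<lambda>g. INF x\<in>B0 (apply_linfty f). apply_linfty g x) f continuous_linfty"
    and "has_hadamard_directional_derivative amplitude_map
      (\<lambda>g. (SUP x\<in>A0 (apply_linfty f). apply_linfty g x)
          - (INF x\<in>B0 (apply_linfty f). apply_linfty g x)) f continuous_linfty"
    by (fact main)+
  assume f: "f \<in> continuous_linfty - {0}"
  then show "has_hadamard_directional_derivative sup_norm_map
      (\<lambda>g. SUP x\<in>M_plus (\<lambda>y. \<bar>apply_linfty f y\<bar>). apply_linfty g x * sgn (apply_linfty f x))
      f continuous_linfty"
    using sup_norm_map_hadamard[OF assms] by simp
  have cont: "continuous_on UNIV (apply_linfty f)"
    using f by (simp add: continuous_linfty_def)
  \<comment> \<open>For continuous \<open>f\<close> the general formulas become the remaining ones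
    by replacing the sets of approximate extremal points with those of actual ones.\<close>
  note main' = main[of f, unfolded A0_eq_M_plus[OF cont] B0_eq_M_minus[OF cont]]
  show "has_hadamard_directional_derivative sup_map
      (\<lambda>g. SUP x\<in>M_plus (apply_linfty f). apply_linfty g x) f continuous_linfty"
    and "has_hadamard_directional_derivative inf_map
      (\<lambda>g. INF x\<in>M_minus (apply_linfty f). apply_linfty g x) f continuous_linfty"
    and "has_hadamard_directional_derivative amplitude_map
      (\<lambda>g. (SUP x\<in>M_plus (apply_linfty f). apply_linfty g x)
          - (INF x\<in>M_minus (apply_linfty f). apply_linfty g x)) f continuous_linfty"
    by (fact main')+
qed

end
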